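(* The correctness probability function $\xi$ is non-submodular. That is, there exist a finite set of models $\mathcal L$, a number of classes $K$ and success probabilities $\mathcal P$ such that the set function $\mathcal S\mapsto\xi(\mathcal S)=\xi_{\mathcal P}(\mathcal S)$ on subsets of $\mathcal L$ violates submodularity: there are $\mathcal S\subseteq\mathcal T\subseteq\mathcal L$ and $l\in\mathcal L\setminus\mathcal T$ with $\xi(\mathcal S\cup\{l\})-\xi(\mathcal S)<\xi(\mathcal T\cup\{l\})-\xi(\mathcal T)$.
   Context: Models and observations. $\mathcal L=\{l_1,\dots,l_L\}$ is a finite set of models, $\mathcal C=\{C_1,\dots,C_K\}$ a set of $K\ge 2$ classes, and $\mathcal P=\{p_1,\dots,p_L\}$ with $p_i\in(0,1)$ the success probability of $l_i$. A random query has a ground-truth class $C_q\in\mathcal C$. The responses $R(l_i)\in\mathcal C$ of the models are mutually independent; $R(l_i)=C_q$ with probability $p_i$, and $R(l_i)$ equals each of the $K-1$ other classes with probability $\frac{1-p_i}{K-1}$. For $\mathcal S\subseteq\mathcal L$, an observation is $\phi_{\mathcal S}=(R(l))_{l\in\mathcal S}$, with probability $\Pr[\phi_{\mathcal S}]=\prod_{l_i\in\mathcal S:R(l_i)=C_q}p_i\prod_{l_j\in\mathcal S:R(l_j)\ne C_q}\frac{1-p_j}{K-1}$. Aggregated prediction. Given $\phi_{\mathcal S}$, let $\mathcal S(C_k)=\{l\in\mathcal S:R(l)=C_k\}$. The belief in $C_k$ is $h(C_k\mid\phi_{\mathcal S})=\prod_{l_i\in\mathcal S(C_k)}\frac{p_i(K-1)}{1-p_i}$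 if $\mathcal S(C_k)\neq\emptyset$, and $h(C_k\mid\phi_{\mathcal S})=\frac{p_{\min}}{2(1-p_{\min})}$ with $p_{\min}=\min\{p_1,\dots,p_L\}$ if $\mathcal S(C_k)=\emptyset$. The aggregated prediction $C(\phi_{\mathcal S})$ is the class with maximal belief, ties broken uniformly at random. Correctness probability. $\xi_{\mathcal P}(\mathcal S)$ is the probability that $C(\phi_{\mathcal S})=C_q$, i.e. the sum of $\Pr[\phi_{\mathcal S}]$ over observations with $C(\phi_{\mathcal S})=C_q$ (an observation with a tie contributes $\Pr[\phi_{\mathcal S}]$ times the probability that the tie is resolved to $C_q$). This does not depend on which class is $C_q$. *)

theory Defs
  imports "HOL-Probability.Probability"
begin

text \<open>
  The models are the indices \<open>{..<L}\<close>, the classes the indices \<open>{..<K}\<close>, and \<open>p i\<close> is the success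
  probability of model \<open>i\<close>. The ground-truth class \<open>q < K\<close> is an explicit parameter. The
  definitions are meant for \<open>K \<ge> 2\<close> and \<open>p i \<in> {0<..<1}\<close> for \<open>i < L\<close>.
\<close>

definition response_pmf :: "nat \<Rightarrow> (nat \<Rightarrow> real) \<Rightarrow> nat \<Rightarrow> nat \<Rightarrow> nat pmf" where
  "response_pmf K p q i =
     bernoulli_pmf (p i) \<bind> (\<lambda>b. if b then return_pmf q else pmf_of_set ({..<K} - {q}))"

text \<open>
  An observation for \<open>S\<close> is an element of \<open>S \<rightarrow>\<^sub>E {..<K}\<close>: it maps each model in \<open>S\<close> to its response
  and is \<open>undefined\<close> elsewhere.
\<close>

definition observation_pmf ::
    "nat \<Rightarrow> (nat \<Rightarrow> real) \<Rightarrow> nat \<Rightarrow> nat set \<Rightarrow> (nat \<Rightarrow> nat) pmf" where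
  "observation_pmf K p q S = Pi_pmf S undefined (response_pmf K p q)"

definition p_min :: "nat \<Rightarrow> (nat \<Rightarrow> real) \<Rightarrow> real" where
  "p_min L p = Min (p ` {..<L})"

definition supporters :: "nat set \<Rightarrow> (nat \<Rightarrow> nat) \<Rightarrow> nat \<Rightarrow> nat set" where
  "supporters S \<phi> k = {i \<in> S. \<phi> i = k}"

definition belief ::
    "nat \<Rightarrow> nat \<Rightarrow> (nat \<Rightarrow> real) \<Rightarrow> nat set \<Rightarrow> (nat \<Rightarrow> nat) \<Rightarrow> nat \<Rightarrow> real" where
  "belief L K p S \<phi> k =
     (if supporters S \<phi> k = {} then p_min L p / (2 * (1 - p_min L p))
      else \<Prod>i\<in>supporters S \<phi> k. p i * (real K - 1) / (1 - p i))"

definition top_classes ::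
    "nat \<Rightarrow> nat \<Rightarrow> (nat \<Rightarrow> real) \<Rightarrow> nat set \<Rightarrow> (nat \<Rightarrow> nat) \<Rightarrow> nat set" where
  "top_classes L K p S \<phi> = {k. is_arg_max (belief L K p S \<phi>) (\<lambda>k. k < K) k}"

definition prediction_pmf ::
    "nat \<Rightarrow> nat \<Rightarrow> (nat \<Rightarrow> real) \<Rightarrow> nat set \<Rightarrow> (nat \<Rightarrow> nat) \<Rightarrow> nat pmf" where
  "prediction_pmf L K p S \<phi> = pmf_of_set (top_classes L K p S \<phi>)"

definition \<xi> :: "nat \<Rightarrow> nat \<Rightarrow> (nat \<Rightarrow> real) \<Rightarrow> nat \<Rightarrow> nat set \<Rightarrow> real" where
  "\<xi> L K p q S = pmf (observation_pmf K p q S \<bind> prediction_pmf L K p S) q"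

lemma pmf_response:
  assumes "K \<ge> 2" "q < K" "0 < p i" "p i < 1" "k < K"
  shows "pmf (response_pmf K p q i) k = (if k = q then p i else (1 - p i) / (real K - 1))"
proof -
  have "{..<K} - {q} \<noteq> {}"
  proof
    assume "{..<K} - {q} = {}"
    then have "card {..<K} \<le> card {q}" by (intro card_mono) auto
    then show False using assms by simp
  qed
  moreover have "card ({..<K} - {q}) = K - 1" using assms by simp
  ultimately show ?thesis
    using assms by (auto simp: response_pmf_def pmf_bind of_nat_diff indicator_def)
qed

lemma set_response:
  assumes "K \<ge> 2" "q < K"
  shows "set_pmf (response_pmf K p q i) \<subseteq> {..<K}"
proof -
  have "{..<K} - {q} \<noteq> {}"
  proof
    assume "{..<K} - {q} = {}"
    then have "card {..<K} \<le> card {q}" by (intro card_mono) auto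
    then show False using assms by simp
  qed
  then have "set_pmf (pmf_of_set ({..<K} - {q})) \<subseteq> {..<K}"
    by (subst set_pmf_of_set) auto
  then show ?thesis
    unfolding response_pmf_def set_bind_pmf
    by (intro UN_least) (simp add: assms split: if_split)
qed

lemma pmf_observation:
  assumes "K \<ge> 2" "q < K" "\<And>i. i < L \<Longrightarrow> 0 < p i \<and> p i < 1" "S \<subseteq> {..<L}"
    and "\<phi> \<in> S \<rightarrow>\<^sub>E {..<K}"
  shows "pmf (observation_pmf K p q S) \<phi> =
    (\<Prod>i\<in>{i\<in>S. \<phi> i = q}. p i) * (\<Prod>i\<in>{i\<in>S. \<phi> i \<noteq> q}. (1 - p i) / (real K - 1))"
proof -
  have fin: "finite S" using assms(4) finite_subset by blast
  have "pmf (observation_pmf K p q S) \<phi> = (\<Prod>i\<in>S. pmf (response_pmf K p q i) (\<phi> i))"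
    unfolding observation_pmf_def using assms(5) fin by (subst pmf_Pi) (auto simp: PiE_def extensional_def)
  also have "\<dots> = (\<Prod>i\<in>S. if \<phi> i = q then p i else (1 - p i) / (real K - 1))"
    using assms by (intro prod.cong refl pmf_response) auto
  also have "\<dots> = (\<Prod>i\<in>S \<inter> {i. \<phi> i = q}. p i) * (\<Prod>i\<in>S \<inter> - {i. \<phi> i = q}. (1 - p i) / (real K - 1))"
    using fin by (rule prod.If_cases)
  also have "S \<inter> {i. \<phi> i = q} = {i\<in>S. \<phi> i = q}" by auto
  also have "S \<inter> - {i. \<phi> i = q} = {i\<in>S. \<phi> i \<noteq> q}" by auto
  finally show ?thesis .
qed

lemma \<xi>_eq_sum:
  assumes "K \<ge> 2" "q < K" "finite S"
  shows "\<xi> L K p q S =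
    (\<Sum>\<phi>\<in>S \<rightarrow>\<^sub>E {..<K}. pmf (observation_pmf K p q S) \<phi> *
       (if q \<in> top_classes L K p S \<phi> then 1 / real (card (top_classes L K p S \<phi>)) else 0))"
proof -
  have top: "finite (top_classes L K p S \<phi>)" "top_classes L K p S \<phi> \<noteq> {}" for \<phi>
  proof -
    have "top_classes L K p S \<phi> \<subseteq> {..<K}" by (auto simp: top_classes_def is_arg_max_def)
    then show "finite (top_classes L K p S \<phi>)" using finite_subset by blast
    have "Max (belief L K p S \<phi> ` {..<K}) \<in> belief L K p S \<phi> ` {..<K}"
      using assms by (intro Max_in) auto
    then obtain k where k: "k < K" "belief L K p S \<phi> k = Max (belief L K p S \<phi> ` {..<K})"
      by auto
    then have "k \<in> top_classes L K p S \<phi>"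
      by (auto simp: top_classes_def is_arg_max_linorder)
    then show "top_classes L K p S \<phi> \<noteq> {}" by blast
  qed
  have supp: "set_pmf (observation_pmf K p q S) \<subseteq> S \<rightarrow>\<^sub>E {..<K}"
  proof
    fix \<phi> assume "\<phi> \<in> set_pmf (observation_pmf K p q S)"
    then have "\<phi> \<in> PiE_dflt S undefined (\<lambda>i. set_pmf (response_pmf K p q i))"
      using assms(3) by (simp add: observation_pmf_def set_Pi_pmf comp_def)
    then show "\<phi> \<in> S \<rightarrow>\<^sub>E {..<K}"
      using set_response[OF assms(1,2)] by (fastforce simp: PiE_dflt_def PiE_def extensional_def)
  qed
  have "\<xi> L K p q S = (\<Sum>\<phi>\<in>S \<rightarrow>\<^sub>E {..<K}. pmf (prediction_pmf L K p S \<phi>) q * pmf (observation_pmf K p q S) \<phi>)"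
    unfolding \<xi>_def pmf_bind using supp assms(3)
    by (intro integral_measure_pmf_real finite_PiE) auto
  also have "\<dots> = (\<Sum>\<phi>\<in>S \<rightarrow>\<^sub>E {..<K}. pmf (observation_pmf K p q S) \<phi> *
       (if q \<in> top_classes L K p S \<phi> then 1 / real (card (top_classes L K p S \<phi>)) else 0))"
    using top by (intro sum.cong refl) (simp add: prediction_pmf_def indicator_def)
  finally show ?thesis .
qed

end

theory Submission
  imports Defs
begin

text \<open>
  Take three models with success probability \<open>3/4\<close> and two classes. A second model changes the
  prediction of the first one only by creating a tie, so it does not improve the correctness
  probability. A third model breaks these ties and yields a majority vote, which is correct
  with probability \<open>27/32\<close>. Hence the third model gains nothing over a single model but a positive
  amount over two.
\<close>

lemma sum_PiE_insert:
  fixes f :: "('a \<Rightarrow> 'b) \<Rightarrow> real"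
  assumes "x \<notin> S"
  shows "(\<Sum>\<phi>\<in>insert x S \<rightarrow>\<^sub>E A. f \<phi>) = (\<Sum>y\<in>A. \<Sum>\<phi>\<in>S \<rightarrow>\<^sub>E A. f (\<phi>(x := y)))"
proof -
  have "(\<Sum>\<phi>\<in>insert x S \<rightarrow>\<^sub>E A. f \<phi>) =
      (\<Sum>(y, \<phi>)\<in>A \<times> (S \<rightarrow>\<^sub>E A). f (\<phi>(x := y)))"
    unfolding PiE_insert_eq
    by (subst sum.reindex[OF inj_combinator[OF assms]]) (simp add: case_prod_unfold)
  then show ?thesis
    by (simp add: sum.cartesian_product)
qed

text \<open>The response of \<open>x\<close> is either \<open>q\<close> or the other class
  \<open>1 - q\<close>. It raises the count of correct responses in the first case and the count of
  wrong ones in the second.\<close>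

lemma sum_PiE_two_insert:
  fixes f :: "nat \<Rightarrow> nat \<Rightarrow> real" and q :: nat
  assumes "finite S" "x \<notin> S" "q < 2"
  shows "(\<Sum>\<phi>\<in>insert x S \<rightarrow>\<^sub>E {..<2}.
        f (card {i \<in> insert x S. \<phi> i = q}) (card {i \<in> insert x S. \<phi> i \<noteq> q})) =
    (\<Sum>\<phi>\<in>S \<rightarrow>\<^sub>E {..<2}. f (Suc (card {i \<in> S. \<phi> i = q})) (card {i \<in> S. \<phi> i \<noteq> q})) +
    (\<Sum>\<phi>\<in>S \<rightarrow>\<^sub>E {..<2}. f (card {i \<in> S. \<phi> i = q}) (Suc (card {i \<in> S. \<phi> i \<noteq> q})))"
proof -
  have update: "{i \<in> insert x S. (\<phi>(x := y)) i = q} =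
        (if y = q then insert x {i \<in> S. \<phi> i = q} else {i \<in> S. \<phi> i = q})"
    "{i \<in> insert x S. (\<phi>(x := y)) i \<noteq> q} =
        (if y = q then {i \<in> S. \<phi> i \<noteq> q} else insert x {i \<in> S. \<phi> i \<noteq> q})" for \<phi> y
    using assms(2) by auto
  have "{..<2} = {q, 1 - q}" "q \<noteq> 1 - q"
    using assms(3) by (auto simp: less_2_cases_iff)
  then show ?thesis
    unfolding sum_PiE_insert[OF assms(2)] update using assms(1,2) by simp
qed

lemma sum_binomial_Suc:
  fixes f :: "nat \<Rightarrow> nat \<Rightarrow> real"
  shows "(\<Sum>k\<le>Suc n. real (Suc n choose k) * f k (Suc n - k)) =
    (\<Sum>k\<le>n. real (n choose k) * f (Suc k) (n - k)) +
    (\<Sum>k\<le>n. real (n choose k) * f k (Suc (n - k)))"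
proof -
  \<comment> \<open>The added term \<open>k = Suc n\<close> has binomial coefficient 0. With equal
    ranges, splitting off \<open>k = 0\<close> leaves Pascal's rule term by term.\<close>
  have "(\<Sum>k\<le>n. real (n choose k) * f k (Suc (n - k))) =
      (\<Sum>k\<le>Suc n. real (n choose k) * f k (Suc n - k))"
    by (simp add: Suc_diff_le binomial_eq_0)
  then show ?thesis
    unfolding sum.atMost_Suc_shift by (simp add: sum.distrib algebra_simps)
qed

text \<open>Both sides obey the same recursion when a model is added. Each summand of that recursion
  shifts one argument of \<open>f\<close>, so the induction must generalize over
  \<open>f\<close>.\<close>

lemma sum_PiE_two_binomial:
  fixes f :: "nat \<Rightarrow> nat \<Rightarrow> real" and q :: nat
  assumes "finite S" "q < 2"
  shows "(\<Sum>\<phi>\<in>S \<rightarrow>\<^sub>E {..<2}. f (card {i \<in> S. \<phi> i = q}) (card {i \<in> S. \<phi> i \<noteq> q})) =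
    (\<Sum>k\<le>card S. real (card S choose k) * f k (card S - k))"
  using assms(1)
proof (induction S arbitrary: f rule: finite_induct)
  case empty
  then show ?case by simp
next
  case (insert x S)
  show ?case
    unfolding sum_PiE_two_insert[OF insert.hyps assms(2)] card_insert_disjoint[OF insert.hyps]
      sum_binomial_Suc
    using insert.IH[of "\<lambda>a. f (Suc a)"] insert.IH[of "\<lambda>a b. f a (Suc b)"] by simp
qed

text \<open>The maximal classes are \<open>{q}\<close>, \<open>{1 - q}\<close> or both, so a tie is
  resolved to \<open>q\<close> with probability 1/2.\<close>

lemma top_classes_two:
  fixes L p S \<phi> q
  defines "b \<equiv> belief L 2 p S \<phi>"
  assumes "q < 2"
  shows "(if q \<in> top_classes L 2 p S \<phi> then 1 / real (card (top_classes L 2 p S \<phi>)) else 0) =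
    (if b (1 - q) < b q then 1 else if b (1 - q) = b q then 1 / 2 else 0)"
proof -
  have top: "top_classes L 2 p S \<phi> = {k. (k = q \<or> k = 1 - q) \<and> b q \<le> b k \<and> b (1 - q) \<le> b k}"
    using assms(2) by (auto simp: top_classes_def is_arg_max_linorder b_def less_2_cases_iff)
  have "b (1 - q) < b q \<Longrightarrow> top_classes L 2 p S \<phi> = {q}"
    "b q < b (1 - q) \<Longrightarrow> top_classes L 2 p S \<phi> = {1 - q}"
    "b (1 - q) = b q \<Longrightarrow> top_classes L 2 p S \<phi> = {q, 1 - q}"
    unfolding top by auto
  moreover have "q \<noteq> 1 - q"
    using assms(2) by (auto simp: less_2_cases_iff)
  ultimately show ?thesis
    by (cases "b q" "b (1 - q)" rule: linorder_cases) auto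
qed

text \<open>With equal success probabilities the prediction is a majority vote. \<open>g a b\<close>
  is the contribution of one observation with \<open>a\<close> correct and \<open>b\<close> wrong
  responses.\<close>

lemma \<xi>_two_classes:
  assumes "q < 2" "S \<subseteq> {..<3}"
  defines "g \<equiv> (\<lambda>(a::nat) (b::nat). (3 / 4) ^ a * (1 / 4) ^ b *
      (if b < a then 1 else if b = a then 1 / 2 else 0) :: real)"
  shows "\<xi> 3 2 (\<lambda>_. 3 / 4) q S =
    (\<Sum>k\<le>card S. real (card S choose k) * g k (card S - k))"
proof -
  have fin: "finite S"
    using assms(2) finite_subset by blast
  \<comment> \<open>The belief in a class with \<open>n\<close> votes: each vote contributes the
    factor (3/4) / (1/4) = 3, and the default without votes is (3/4) / (2 * (1/4)) = 3/2. As 3/2 <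
    3, an unsupported class still ranks below one with a vote.\<close>
  define v where "v n = (if n = 0 then 3 / 2 else 3 ^ n :: real)" for n :: nat
  have "v m < v n" if "m < n" for m n
  proof -
    have "(3::real) ^ 1 \<le> 3 ^ n"
      using that by (intro power_increasing) auto
    then show ?thesis
      using that by (auto simp: v_def)
  qed
  then have mono: "strict_mono v"
    by (simp add: strict_mono_def)
  have "(\<lambda>_. 3 / 4 :: real) ` {..<3::nat} = {3 / 4}"
    by (rule image_constant[of 0]) simp
  then have p_min: "p_min 3 (\<lambda>_. 3 / 4) = 3 / 4"
    by (simp add: p_min_def)
  have belief: "belief 3 2 (\<lambda>_. 3 / 4) S \<phi> k = v (card {i \<in> S. \<phi> i = k})" for \<phi> k
    using fin unfolding belief_def supporters_def p_min v_def by auto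
  have wrong: "{i \<in> S. \<phi> i = 1 - q} = {i \<in> S. \<phi> i \<noteq> q}" if "\<phi> \<in> S \<rightarrow>\<^sub>E {..<2}" for \<phi>
  proof -
    have "\<phi> i = 1 - q \<longleftrightarrow> \<phi> i \<noteq> q" if "i \<in> S" for i
      using PiE_mem[OF \<open>\<phi> \<in> _\<close> that] assms(1) by (auto simp: less_2_cases_iff)
    then show ?thesis by blast
  qed
  have weight: "pmf (observation_pmf 2 (\<lambda>_. 3 / 4) q S) \<phi> =
      (3 / 4) ^ card {i \<in> S. \<phi> i = q} * (1 / 4) ^ card {i \<in> S. \<phi> i \<noteq> q}"
    if "\<phi> \<in> S \<rightarrow>\<^sub>E {..<2}" for \<phi>
    using pmf_observation[OF _ assms(1) _ assms(2) that, of "\<lambda>_. 3 / 4"] by simp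
  show ?thesis
    \<comment> \<open>Expanding the binomial sum back over observations lets both sides be compared
      termwise.\<close>
    unfolding sum_PiE_two_binomial[OF fin assms(1), symmetric]
      \<xi>_eq_sum[OF order_refl assms(1) fin] top_classes_two[OF assms(1)]
    by (intro sum.cong refl)
      (simp only: g_def weight belief wrong strict_mono_less[OF mono] strict_mono_eq[OF mono])
qed

text \<open>For two models, 9/16 + (1/2) * 2 * (3/16) = 3/4; for three, 27/64 + 3 * (9/64) =
  27/32.\<close>

lemma \<xi>_majority:
  assumes "q < 2" "S \<subseteq> {..<3}"
  shows "card S = 1 \<Longrightarrow> \<xi> 3 2 (\<lambda>_. 3 / 4) q S = 3 / 4"
    and "card S = 2 \<Longrightarrow> \<xi> 3 2 (\<lambda>_. 3 / 4) q S = 3 / 4"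
    and "card S = 3 \<Longrightarrow> \<xi> 3 2 (\<lambda>_. 3 / 4) q S = 27 / 32"
  unfolding \<xi>_two_classes[OF assms] by (simp_all add: numeral_eq_Suc)

theorem lemma2:
  shows "\<exists>(L::nat) (K::nat) (p::nat \<Rightarrow> real).
    K \<ge> 2 \<and> (\<forall>i<L. p i \<in> {0<..<1}) \<and>
    (\<exists>S T l. S \<subseteq> T \<and> T \<subseteq> {..<L} \<and> l \<in> {..<L} - T \<and>
      (\<forall>q<K. \<xi> L K p q (S \<union> {l}) - \<xi> L K p q S < \<xi> L K p q (T \<union> {l}) - \<xi> L K p q T))"
proof -
  \<comment> \<open>The two gains are 0 and 27/32 - 3/4 = 3/32.\<close>
  have "\<xi> 3 2 (\<lambda>_. 3 / 4) q ({0} \<union> {2}) - \<xi> 3 2 (\<lambda>_. 3 / 4) q {0} <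
      \<xi> 3 2 (\<lambda>_. 3 / 4) q ({0, 1} \<union> {2}) - \<xi> 3 2 (\<lambda>_. 3 / 4) q {0, 1}" if "q < 2" for q
    using that by (simp add: \<xi>_majority)
  then show ?thesis
    by (intro exI[of _ 3] exI[of _ 2] exI[of _ "\<lambda>_. 3 / 4"] exI[of _ "{0}"] exI[of _ "{0, 1}"]
        conjI) auto
qed

end
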